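(* Let $D\subset\mathbb C^n$ be a bounded domain of class $C^{1,1}$, and let $r$ be any defining function for $D$ that is of class $C^{1,1}$ in a neighborhood of $\overline D$. Then the condition (0) there is a constant $c>0$ such that $|r_\zeta\cdot(\zeta-z)|\ge c|\zeta-z|^2$ for all $z\in\overline D$, $\zeta\in\partial D$ is equivalent to each of the following conditions on the same $r$: (1) there are a neighborhood $U$ of $\overline D$ and a constant $c_1>0$ such that $|r_\zeta\cdot(\zeta-z)|\ge c_1|\zeta-z|^2$ for all $z\in\overline D$, $\zeta\in U\setminus D$; (2) there are a neighborhood $U$ of $\overline D$ and a constant $c_2>0$ such that $|r_\zeta\cdot(\zeta-z)|\ge c_2\big(r(\zeta)-r(z)+|\zeta-z|^2\big)$ for all $z\in\overline D$, $\zeta\in U\setminus D$; (3) there is a constant $c_3>0$ such that $|r_\zeta\cdot(\zeta-z)|\ge c_3|\zeta-z|^2$ for all $\zeta,z\in\partial D$. The neighborhoods $U$ in (1) and (2) need not be the same.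
   Context: A defining function of $D$ is a real-valued function $r$ of class at least $C^1$ on a neighborhood of $\overline D$ such that, in that neighborhood, $D=\{r<0\}$, $\partial D=\{r=0\}$, and $dr\neq0$ on $\partial D$. $C^{1,1}$ means $C^1$ with Lipschitz first-order derivatives; a domain is of class $C^{1,1}$ if it has a defining function of class $C^{1,1}$ on a neighborhood of its closure. Notation: $r_\zeta=(\partial r/\partial\zeta_1,\dots,\partial r/\partial\zeta_n)$ evaluated at $\zeta$ (Wirtinger derivatives), and $a\cdot b=\sum_{j=1}^n a_jb_j$ for $a,b\in\mathbb C^n$ (bilinear, no conjugation). *)

theory Defs
  imports "HOL-Analysis.Analysis"
begin

definition C1_on :: "'a::real_normed_vector set \<Rightarrow> ('a \<Rightarrow> real) \<Rightarrow> bool" where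
  "C1_on W f \<longleftrightarrow>
     (\<exists>f' :: 'a \<Rightarrow> 'a \<Rightarrow>\<^sub>L real.
        (\<forall>x\<in>W. (f has_derivative blinfun_apply (f' x)) (at x)) \<and> continuous_on W f')"

definition C11_on :: "'a::real_normed_vector set \<Rightarrow> ('a \<Rightarrow> real) \<Rightarrow> bool" where
  "C11_on W f \<longleftrightarrow>
     (\<exists>f' :: 'a \<Rightarrow> 'a \<Rightarrow>\<^sub>L real.
        (\<forall>x\<in>W. (f has_derivative blinfun_apply (f' x)) (at x)) \<and> (\<exists>L. L-lipschitz_on W f'))"

text \<open>Functions are total here, so the neighborhood \<open>W\<close> of the closure of \<open>D\<close> on which a
  defining function \<open>r\<close> lives is an explicit argument; values of \<open>r\<close> outside \<open>W\<close> are
  irrelevant.\<close>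

definition defining_function ::
    "(complex ^ 'n \<Rightarrow> real) \<Rightarrow> (complex ^ 'n) set \<Rightarrow> (complex ^ 'n) set \<Rightarrow> bool" where
  "defining_function r W D \<longleftrightarrow>
     open W \<and> closure D \<subseteq> W \<and> C1_on W r \<and>
     D = {x \<in> W. r x < 0} \<and> frontier D = {x \<in> W. r x = 0} \<and>
     (\<forall>x \<in> frontier D. frechet_derivative r (at x) \<noteq> (\<lambda>_. 0))"

definition C11_defining_function ::
    "(complex ^ 'n \<Rightarrow> real) \<Rightarrow> (complex ^ 'n) set \<Rightarrow> (complex ^ 'n) set \<Rightarrow> bool" where
  "C11_defining_function r W D \<longleftrightarrow>
     defining_function r W D \<and> (\<exists>V. open V \<and> closure D \<subseteq> V \<and> V \<subseteq> W \<and> C11_on V r)"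

definition is_domain :: "(complex ^ 'n) set \<Rightarrow> bool" where
  "is_domain D \<longleftrightarrow> open D \<and> connected D \<and> D \<noteq> {}"

definition C11_domain :: "(complex ^ 'n) set \<Rightarrow> bool" where
  "C11_domain D \<longleftrightarrow> is_domain D \<and> (\<exists>r W. C11_defining_function r W D)"

text \<open>The vector of Wirtinger derivatives
  \<open>\<partial>r/\<partial>\<zeta>\<^sub>j = (\<partial>r/\<partial>x\<^sub>j - \<i> \<partial>r/\<partial>y\<^sub>j) / 2\<close>, where \<open>\<zeta>\<^sub>j = x\<^sub>j + \<i> y\<^sub>j\<close>;
  the real partial derivatives are the values of the real Frechet derivative on
  \<open>axis j 1\<close> and \<open>axis j \<i>\<close>.\<close>

definition wirtinger_grad :: "(complex ^ 'n \<Rightarrow> real) \<Rightarrow> complex ^ 'n \<Rightarrow> complex ^ 'n" where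
  "wirtinger_grad r \<zeta> =
     (\<chi> j. (of_real (frechet_derivative r (at \<zeta>) (axis j 1))
            - \<i> * of_real (frechet_derivative r (at \<zeta>) (axis j \<i>))) / 2)"

text \<open>The complex bilinear pairing (no conjugation), unlike the real inner product.\<close>

definition cdot :: "complex ^ 'n \<Rightarrow> complex ^ 'n \<Rightarrow> complex" where
  "cdot a b = (\<Sum>j\<in>UNIV. a $ j * b $ j)"

end

theory Submission
  imports Defs
begin

text \<open>(3) implies (0) with the same constant by following the ray from \<open>\<zeta>\<close> through \<open>z\<close> until it
  leaves \<open>D\<close>. For (0) implies (2), Taylor expansion at \<open>\<zeta> \<in> \<partial>D\<close> bounds \<open>- r z\<close> by the pairing
  plus \<open>O(|\<zeta> - z|\<^sup>2)\<close>, so (0) already gives (2) on the frontier; for \<open>\<zeta>\<close> outside \<open>D\<close> and \<open>z\<close> close to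
  it, both points are translated into the domain by one transversal vector that puts \<open>\<zeta>\<close> on the
  frontier, and for \<open>z\<close> away from \<open>\<zeta>\<close> a perturbation of \<open>\<zeta>\<close> suffices. On \<open>U - D\<close> the
  difference \<open>r \<zeta> - r z\<close> is nonnegative, so (2) implies (1).\<close>

section \<open>The Wirtinger pairing in terms of the real derivative\<close>

text \<open>Both sides are real-linear in \<open>x\<close>, so it suffices to expand along
  \<open>axis j 1\<close> and \<open>axis j \<i>\<close>. The pairing is the complex-linear part of
  the real derivative, and estimates for it reduce to coordinate-free estimates for
  \<open>f\<close>.\<close>

lemma cdot_wirtinger_grad:
  fixes r :: "complex ^ 'n \<Rightarrow> real"
  assumes "(r has_derivative f) (at \<zeta>)"
  shows "cdot (wirtinger_grad r \<zeta>) x = (of_real (f x) - \<i> * of_real (f (\<i> *s x))) / 2"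
proof -
  have fd: "frechet_derivative r (at \<zeta>) = f"
    using frechet_derivative_at[OF assms] by simp
  interpret f: linear f
    using assms by (rule has_derivative_linear)
  have expand: "y = (\<Sum>j\<in>UNIV. Re (y $ j) *\<^sub>R axis j 1 + Im (y $ j) *\<^sub>R axis j \<i>)"
    for y :: "complex ^ 'n"
    by (simp add: vec_eq_iff axis_def complex_eq_iff if_distrib if_distribR
        cong: if_cong sum.cong)
  have f_expand: "f y = (\<Sum>j\<in>UNIV. Re (y $ j) * f (axis j 1) + Im (y $ j) * f (axis j \<i>))" for y
    by (subst expand) (simp add: f.sum f.add f.scale)
  show ?thesis
    unfolding cdot_def wirtinger_grad_def fd f_expand[of x] f_expand[of "\<i> *s x"]
    by (simp add: complex_eq_iff sum_distrib_left sum_distrib_right sum_divide_distrib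
        sum.distrib sum_subtractf sum_negf add_divide_distrib diff_divide_distrib algebra_simps)
qed

lemma norm_ii_vector_scalar_mult [simp]: "norm (\<i> *s x) = norm x" for x :: "complex ^ 'n"
  by (simp add: norm_vec_def norm_mult)

lemma cmod_half_diff_ii_le:
  fixes g :: "(complex ^ 'n) \<Rightarrow>\<^sub>L real"
  shows "cmod ((of_real (g x) - \<i> * of_real (g (\<i> *s x))) / 2) \<le> norm g * norm x"
proof -
  have "\<bar>g x\<bar> \<le> norm g * norm x" "\<bar>g (\<i> *s x)\<bar> \<le> norm g * norm x"
    using norm_blinfun[of g x] norm_blinfun[of g "\<i> *s x"] by simp_all
  moreover have "cmod (of_real (g x) - \<i> * of_real (g (\<i> *s x))) \<le> \<bar>g x\<bar> + \<bar>g (\<i> *s x)\<bar>"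
    by (rule order_trans[OF norm_triangle_ineq4]) (simp add: norm_mult)
  ultimately show ?thesis
    by (simp add: norm_divide)
qed

lemma cdot_add_right: "cdot a (x + y) = cdot a x + cdot a y"
  by (simp add: cdot_def sum.distrib algebra_simps)

lemma cdot_scaleR_right: "cdot a (t *\<^sub>R x) = t *\<^sub>R cdot a x"
  by (simp add: cdot_def scaleR_sum_right)

section \<open>Segments: the mean value theorem and crossing the frontier\<close>

text \<open>The one-dimensional mean value theorem on the segment from \<open>x\<close> to
  \<open>y\<close>. The bound on \<open>norm (u - x)\<close> is kept because, with a Lipschitz
  derivative, it makes the first-order Taylor error at \<open>x\<close> quadratic.\<close>

lemma mvt_convex_real:
  fixes f :: "'a::real_normed_vector \<Rightarrow> real"
  assumes "convex S" "x \<in> S" "y \<in> S"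
    and der: "\<And>u. u \<in> S \<Longrightarrow> (f has_derivative f' u) (at u)"
  obtains u where "u \<in> S" "norm (u - x) \<le> norm (y - x)" "f y - f x = f' u (y - x)"
proof -
  let ?g = "\<lambda>t::real. x + t *\<^sub>R (y - x)"
  have in_S: "?g t \<in> S" if "t \<in> {0..1}" for t
    using convexD_alt[OF assms(1-3), of t] that by (simp add: algebra_simps)
  have "\<exists>t\<in>{0..1}. f (?g 1) - f (?g 0) = (\<lambda>h. f' (?g t) (h *\<^sub>R (y - x))) (1 - 0)"
  proof (rule mvt_very_simple)
    fix t :: real assume "0 \<le> t" "t \<le> 1"
    then have "(f has_derivative f' (?g t)) (at (?g t))"
      using der in_S by simp
    then show "((\<lambda>t. f (?g t)) has_derivative (\<lambda>h. f' (?g t) (h *\<^sub>R (y - x)))) (at t within {0..1})"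
      by (rule has_derivative_compose[rotated]) (auto intro!: derivative_eq_intros)
  qed simp
  then obtain t where t: "t \<in> {0..1}" "f y - f x = f' (?g t) (y - x)"
    by auto
  show thesis
    by (rule that[OF in_S[OF t(1)] _ t(2)]) (use t(1) in \<open>auto intro: mult_left_le_one_le\<close>)
qed

lemma closed_segment_meets_frontier:
  fixes S :: "'a::real_normed_vector set"
  assumes "x \<in> S" "y \<notin> S"
  obtains u where "u \<in> frontier S" "u \<in> closed_segment x y"
  using connected_Int_frontier[of "closed_segment x y" S] assms by auto

text \<open>A ray from \<open>\<zeta>\<close> through \<open>z \<in> D\<close> leaves the bounded set \<open>D\<close> beyond \<open>z\<close>, and along the
  ray the quotient of the pairing by the squared distance decreases.\<close>
lemma cdot_bound_closure_if_frontier: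
  fixes D :: "(complex ^ 'n) set"
  assumes "bounded D" "open D" "\<zeta> \<in> frontier D" "0 < c"
    and bound: "\<And>z. z \<in> frontier D \<Longrightarrow> c * (norm (\<zeta> - z))\<^sup>2 \<le> cmod (cdot w (\<zeta> - z))"
    and "z \<in> closure D"
  shows "c * (norm (\<zeta> - z))\<^sup>2 \<le> cmod (cdot w (\<zeta> - z))"
proof (cases "z \<in> D")
  case False
  then show ?thesis
    using assms by (simp add: frontier_def interior_open)
next
  case True
  have "\<zeta> \<notin> D"
    using assms by (simp add: frontier_def interior_open)
  with True have pos: "0 < norm (z - \<zeta>)"
    by auto
  obtain B where B: "\<And>x. x \<in> D \<Longrightarrow> norm x \<le> B"
    using \<open>bounded D\<close> by (auto simp: bounded_iff)
  \<comment> \<open>Chosen so that \<open>T * norm (z - \<zeta>)\<close> exceeds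
    \<open>\<bar>B\<bar> + norm \<zeta>\<close>, which puts \<open>y\<close> outside the ball of
    radius \<open>B\<close> containing \<open>D\<close>.\<close>
  define T where "T = 1 + (\<bar>B\<bar> + norm \<zeta> + 1) / norm (z - \<zeta>)"
  define y where "y = \<zeta> + T *\<^sub>R (z - \<zeta>)"
  have T: "1 \<le> T"
    by (simp add: T_def)
  have "T * norm (z - \<zeta>) = norm (z - \<zeta>) + \<bar>B\<bar> + norm \<zeta> + 1"
    using pos by (simp add: T_def field_simps)
  moreover have "T * norm (z - \<zeta>) \<le> norm y + norm \<zeta>"
    using norm_triangle_ineq4[of y \<zeta>] T by (simp add: y_def)
  ultimately have "B < norm y"
    using pos by linarith
  then have "y \<notin> D"
    using B by force
  then obtain u where u: "u \<in> frontier D" "u \<in> closed_segment z y"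
    using closed_segment_meets_frontier True by metis
  then obtain a where a: "0 \<le> a" "a \<le> 1" "u = (1 - a) *\<^sub>R z + a *\<^sub>R y"
    by (auto simp: in_segment)
  \<comment> \<open>The parameter of \<open>u\<close> on the ray from \<zeta> through
    \<open>z\<close>; it is at least 1 because \<open>u\<close> lies between \<open>z\<close> and
    \<open>y\<close>.\<close>
  define t where "t = 1 + a * (T - 1)"
  have t: "1 \<le> t"
    using a T by (simp add: t_def)
  have "u = \<zeta> + t *\<^sub>R (z - \<zeta>)"
    by (simp add: a(3) t_def y_def algebra_simps)
  then have ut: "\<zeta> - u = t *\<^sub>R (\<zeta> - z)"
    by (simp add: algebra_simps)
  have "c * (t\<^sup>2 * (norm (\<zeta> - z))\<^sup>2) \<le> t * cmod (cdot w (\<zeta> - z))"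
    using bound[OF u(1)] t by (simp add: ut cdot_scaleR_right power_mult_distrib)
  then have "t * (c * norm (\<zeta> - z)^2 * t) \<le> t * cmod (cdot w (\<zeta> - z))"
    by (simp add: power2_eq_square mult_ac)
  then have "c * norm (\<zeta> - z)^2 * t \<le> cmod (cdot w (\<zeta> - z))"
    using t by simp
  moreover have "c * norm (\<zeta> - z)^2 * 1 \<le> c * norm (\<zeta> - z)^2 * t"
    using t \<open>0 < c\<close> by (intro mult_left_mono) auto
  ultimately show ?thesis
    by simp
qed

section \<open>Local estimates for a defining function with Lipschitz derivative\<close>

text \<open>Fixes one derivative \<open>f'\<close> and one Lipschitz constant on a neighborhood
  \<open>V\<close> of the closure, which may be smaller than the one on which \<open>r\<close> is
  given as a defining function; signs of \<open>r\<close> are therefore only interpreted on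
  \<open>V\<close>.\<close>

locale c11_defining =
  fixes D V :: "(complex ^ 'n) set" and r :: "complex ^ 'n \<Rightarrow> real"
    and f' :: "complex ^ 'n \<Rightarrow> (complex ^ 'n) \<Rightarrow>\<^sub>L real" and L :: real
  assumes bounded_D: "bounded D"
    and open_D: "open D"
    and open_V: "open V"
    and closure_subset: "closure D \<subseteq> V"
    and derivative: "x \<in> V \<Longrightarrow> (r has_derivative f' x) (at x)"
    and lipschitz: "L-lipschitz_on V f'"
    and neg_iff: "x \<in> V \<Longrightarrow> r x < 0 \<longleftrightarrow> x \<in> D"
    and zero_iff: "x \<in> V \<Longrightarrow> r x = 0 \<longleftrightarrow> x \<in> frontier D"
    and nonzero: "p \<in> frontier D \<Longrightarrow> f' p \<noteq> 0"
begin

abbreviation pairing :: "complex ^ 'n \<Rightarrow> complex ^ 'n \<Rightarrow> complex" where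
  "pairing \<zeta> \<equiv> cdot (wirtinger_grad r \<zeta>)"

lemma L_nonneg: "0 \<le> L"
  using lipschitz by (rule lipschitz_on_nonneg)

lemma derivative_diff_le: "x \<in> V \<Longrightarrow> y \<in> V \<Longrightarrow> norm (f' x - f' y) \<le> L * norm (x - y)"
  using lipschitz_onD[OF lipschitz] by (simp add: dist_norm)

lemma closure_iff: "x \<in> V \<Longrightarrow> x \<in> closure D \<longleftrightarrow> r x \<le> 0"
  using neg_iff zero_iff closure_Un_frontier[of D] by force

lemma frontier_in_V: "p \<in> frontier D \<Longrightarrow> p \<in> V"
  using closure_subset by (auto simp: frontier_def)

lemma pairing_eq:
  "\<zeta> \<in> V \<Longrightarrow> pairing \<zeta> x = (of_real (f' \<zeta> x) - \<i> * of_real (f' \<zeta> (\<i> *s x))) / 2"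
  using derivative by (rule cdot_wirtinger_grad)

lemma norm_pairing_le: "\<zeta> \<in> V \<Longrightarrow> cmod (pairing \<zeta> x) \<le> norm (f' \<zeta>) * norm x"
  by (simp only: pairing_eq cmod_half_diff_ii_le)

text \<open>The pairing is linear in the derivative, so the difference is the same expression formed
  with \<open>f' \<zeta> - f' \<xi>\<close>, whose norm the Lipschitz condition controls.\<close>

lemma norm_pairing_diff_le:
  assumes "\<zeta> \<in> V" "\<xi> \<in> V"
  shows "cmod (pairing \<zeta> x - pairing \<xi> x) \<le> L * norm (\<zeta> - \<xi>) * norm x"
proof -
  have "pairing \<zeta> x - pairing \<xi> x =
      (of_real ((f' \<zeta> - f' \<xi>) x) - \<i> * of_real ((f' \<zeta> - f' \<xi>) (\<i> *s x))) / 2"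
    using assms by (simp add: pairing_eq minus_blinfun.rep_eq field_simps)
  then have "cmod (pairing \<zeta> x - pairing \<xi> x) \<le> norm (f' \<zeta> - f' \<xi>) * norm x"
    by (simp only: cmod_half_diff_ii_le)
  also have "\<dots> \<le> L * norm (\<zeta> - \<xi>) * norm x"
    using assms by (intro mult_right_mono derivative_diff_le) auto
  finally show ?thesis .
qed

text \<open>The real part of the pairing is half of the real derivative.\<close>

lemma derivative_le_norm_pairing: "\<zeta> \<in> V \<Longrightarrow> f' \<zeta> x \<le> 2 * cmod (pairing \<zeta> x)"
  using complex_Re_le_cmod[of "pairing \<zeta> x"] by (simp add: pairing_eq)

lemma mvt_ball:
  assumes "ball p \<rho> \<subseteq> V" "x \<in> ball p \<rho>" "y \<in> ball p \<rho>"
  obtains u where "u \<in> ball p \<rho>" "norm (u - x) \<le> norm (y - x)" "r y - r x = f' u (y - x)"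
  by (rule mvt_convex_real[of "ball p \<rho>" x y r f']) (use assms derivative in auto)

text \<open>As \<open>r p = 0\<close>, the mean value theorem gives
  \<open>- r z = f' u (p - z)\<close>. Replacing \<open>f' u\<close> by \<open>f' p\<close> costs
  \<open>L\<close> times the squared distance, and \<open>f' p (p - z)\<close> is at most twice the
  pairing.\<close>

lemma frontier_bound_strengthen:
  assumes p: "p \<in> frontier D" and ball: "ball p \<rho> \<subseteq> V" and z: "z \<in> ball p \<rho>"
    and "0 < c" and bound: "c * (norm (p - z))\<^sup>2 \<le> cmod (pairing p (p - z))"
  shows "(norm (p - z))\<^sup>2 - r z \<le> (2 + (L + 1) / c) * cmod (pairing p (p - z))"
proof -
  have pV: "p \<in> V"
    using p by (rule frontier_in_V)
  have "0 < \<rho>"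
    using z by (metis mem_ball dist_not_less_zero less_le_trans not_le)
  then obtain u where u: "u \<in> ball p \<rho>" "norm (u - p) \<le> norm (z - p)" "r z - r p = f' u (z - p)"
    using mvt_ball[OF ball, of p z] z by (metis centre_in_ball)
  have uV: "u \<in> V"
    using u ball by auto
  have "r p = 0"
    using p pV zero_iff by blast
  then have "- r z = f' u (p - z)"
    using u(3) by (simp add: blinfun.diff_right)
  also have "\<dots> = f' p (p - z) + (f' u - f' p) (p - z)"
    by (simp add: minus_blinfun.rep_eq)
  also have "(f' u - f' p) (p - z) \<le> norm (f' u - f' p) * norm (p - z)"
    using norm_blinfun[of "f' u - f' p" "p - z"] by simp
  also have "\<dots> \<le> (L * norm (u - p)) * norm (p - z)"
    using uV pV by (intro mult_right_mono derivative_diff_le) auto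
  also have "\<dots> \<le> (L * norm (p - z)) * norm (p - z)"
    using u(2) L_nonneg by (intro mult_right_mono mult_left_mono) (auto simp: norm_minus_commute)
  finally have "- r z \<le> 2 * cmod (pairing p (p - z)) + L * (norm (p - z))\<^sup>2"
    using derivative_le_norm_pairing[OF pV, of "p - z"] by (simp add: power2_eq_square)
  \<comment> \<open>\<open>L\<close> accounts for the Taylor error, and the additional 1 for the
    squared distance on the left of the claim.\<close>
  moreover have "(L + 1) * (norm (p - z))\<^sup>2 \<le> (L + 1) * (cmod (pairing p (p - z)) / c)"
    using bound \<open>0 < c\<close> L_nonneg by (intro mult_left_mono) (auto simp: field_simps)
  ultimately show ?thesis
    by (simp add: algebra_simps)
qed

section \<open>Uniform transversal directions and the estimate for nearby points\<close>

text \<open>The mean value theorem on the segment in direction \<open>v\<close>. It is used both to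
  bring \<zeta> down to the frontier and to lower \<open>r z\<close> under the same
  translation.\<close>

lemma descend:
  assumes "ball p \<rho> \<subseteq> V" "x \<in> ball p \<rho>" "x - s *\<^sub>R v \<in> ball p \<rho>" "0 \<le> s"
    and v: "\<And>x. x \<in> ball p \<rho> \<Longrightarrow> m \<le> f' x v"
  shows "r (x - s *\<^sub>R v) \<le> r x - m * s"
proof -
  obtain u where u: "u \<in> ball p \<rho>" "r (x - s *\<^sub>R v) - r x = f' u ((x - s *\<^sub>R v) - x)"
    by (rule mvt_ball[OF assms(1-3)])
  have "s * m \<le> s * f' u v"
    using v[OF u(1)] \<open>0 \<le> s\<close> by (rule mult_left_mono)
  with u(2) show ?thesis
    by (simp add: blinfun.minus_right blinfun.scaleR_right mult.commute)
qed

lemma increment_le: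
  assumes "ball p \<rho> \<subseteq> V" "x \<in> ball p \<rho>" "y \<in> ball p \<rho>"
    and M: "\<And>x. x \<in> ball p \<rho> \<Longrightarrow> norm (f' x) \<le> M"
  shows "r y - r x \<le> M * norm (y - x)"
proof -
  obtain u where u: "u \<in> ball p \<rho>" "r y - r x = f' u (y - x)"
    by (rule mvt_ball[OF assms(1-3)])
  have "f' u (y - x) \<le> norm (f' u) * norm (y - x)"
    using norm_blinfun[of "f' u" "y - x"] by simp
  also have "\<dots> \<le> M * norm (y - x)"
    using M[OF u(1)] by (rule mult_right_mono) simp
  finally show ?thesis
    using u(2) by simp
qed

text \<open>On the compact frontier the continuous function \<open>norm (f' p)\<close> is bounded
  above and away from 0. The Lipschitz condition then yields one radius on which \<open>f'\<close>
  varies by at most \<open>m\<close>, so a direction chosen at \<open>p\<close> stays transversal on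
  the whole ball.\<close>

lemma collar:
  obtains \<rho> m M where "0 < \<rho>" "0 < m" "m \<le> M"
    and "\<And>p. p \<in> closure D \<Longrightarrow> ball p \<rho> \<subseteq> V"
    and "\<And>p x. p \<in> frontier D \<Longrightarrow> x \<in> ball p \<rho> \<Longrightarrow> norm (f' x) \<le> M"
    and "\<And>p. p \<in> frontier D \<Longrightarrow> \<exists>v. norm v = 1 \<and> (\<forall>x\<in>ball p \<rho>. m \<le> f' x v)"
proof -
  have cpt: "compact (closure D)" "compact (frontier D)"
    using bounded_D by (simp_all add: compact_frontier_bounded)
  obtain \<epsilon> where \<epsilon>: "0 < \<epsilon>" "(\<Union>x\<in>closure D. ball x \<epsilon>) \<subseteq> V"
    using compact_subset_open_imp_ball_epsilon_subset[OF cpt(1) open_V closure_subset] by metis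
  have cont: "continuous_on (frontier D) (\<lambda>p. norm (f' p))"
    using lipschitz_on_continuous_on[OF lipschitz] frontier_in_V
    by (intro continuous_on_norm) (auto intro: continuous_on_subset)
  \<comment> \<open>The factor 4 leaves room for two losses: choosing a direction with derivative at
    least \<open>2 * m\<close>, and the variation by \<open>m\<close> over the ball.\<close>
  obtain m where m: "0 < m" "\<And>p. p \<in> frontier D \<Longrightarrow> 4 * m \<le> norm (f' p)"
  proof (cases "frontier D = {}")
    case True
    with that[of 1] show thesis by simp
  next
    case False
    then obtain q where "q \<in> frontier D" "\<forall>p\<in>frontier D. norm (f' q) \<le> norm (f' p)"
      using continuous_attains_inf[OF cpt(2) _ cont] by blast
    with that[of "norm (f' q) / 4"] nonzero show thesis by auto
  qed
  have "bounded ((\<lambda>p. norm (f' p)) ` frontier D)"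
    by (intro compact_imp_bounded compact_continuous_image cont cpt)
  then obtain M where M: "\<And>p. p \<in> frontier D \<Longrightarrow> norm (f' p) \<le> M"
    by (auto simp: bounded_iff)
  \<comment> \<open>Dividing by \<open>L + 1\<close> instead of \<open>L\<close> covers
    \<open>L = 0\<close>.\<close>
  define \<rho> where "\<rho> = min \<epsilon> (m / (L + 1))"
  have \<rho>: "0 < \<rho>" "\<rho> \<le> \<epsilon>" "L * \<rho> \<le> m"
  proof -
    show "0 < \<rho>" "\<rho> \<le> \<epsilon>"
      using \<epsilon> m L_nonneg by (simp_all add: \<rho>_def)
    have "L * \<rho> \<le> (L + 1) * (m / (L + 1))"
      using m L_nonneg by (intro mult_mono) (auto simp: \<rho>_def \<epsilon>(1) less_imp_le)
    then show "L * \<rho> \<le> m"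
      using L_nonneg by simp
  qed
  have ball: "ball p \<rho> \<subseteq> V" if "p \<in> closure D" for p
    using \<epsilon> \<rho> that by (meson UN_subset_iff subset_ball subset_trans)
  have near: "norm (f' x - f' p) \<le> m" if "p \<in> frontier D" "x \<in> ball p \<rho>" for p x
  proof -
    have "norm (f' x - f' p) \<le> L * norm (x - p)"
      using that frontier_in_V ball[of p]
      by (intro derivative_diff_le) (auto simp: frontier_def)
    also have "\<dots> \<le> L * \<rho>"
      using that L_nonneg by (intro mult_left_mono) (auto simp: dist_norm norm_minus_commute)
    finally show ?thesis
      using \<rho> by simp
  qed
  show thesis
  \<comment> \<open>The absolute value secures \<open>m \<le> M\<close> even if the frontier is
    empty and the bound \<open>M\<close> is arbitrary.\<close>
  proof (rule that[of \<rho> m "\<bar>M\<bar> + m"])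
    fix p x assume px: "p \<in> frontier D" "x \<in> ball p \<rho>"
    show "norm (f' x) \<le> \<bar>M\<bar> + m"
      using near[OF px] M[OF px(1)] norm_triangle_sub[of "f' x" "f' p"] by linarith
  next
    fix p assume p: "p \<in> frontier D"
    have "\<exists>w. 2 * m * norm w < norm (f' p w)"
    proof (rule ccontr)
      assume "\<nexists>w. 2 * m * norm w < norm (f' p w)"
      then have "norm (f' p) \<le> 2 * m"
        using m(1) by (intro norm_blinfun_bound) (auto simp: not_less)
      then show False
        using m(1) m(2)[OF p] by simp
    qed
    then obtain w where w: "2 * m * norm w < \<bar>f' p w\<bar>"
      by auto
    then have "w \<noteq> 0"
      by auto
    have "0 \<le> 2 * m * norm w"
      using m(1) by simp
    with w have "f' p w \<noteq> 0"
      by auto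
    \<comment> \<open>The unit vector along \<open>w\<close>, with the sign that makes the
      derivative positive.\<close>
    define v where "v = (sgn (f' p w) / norm w) *\<^sub>R w"
    have v: "norm v = 1"
      using \<open>f' p w \<noteq> 0\<close> \<open>w \<noteq> 0\<close> by (simp add: v_def abs_sgn_eq)
    have "2 * m \<le> \<bar>f' p w\<bar> / norm w"
      using w \<open>w \<noteq> 0\<close> by (simp add: field_simps)
    also have "\<dots> = f' p v"
      by (simp add: v_def blinfun.scaleR_right abs_sgn mult.commute)
    finally have pv: "2 * m \<le> f' p v" .
    have "m \<le> f' x v" if "x \<in> ball p \<rho>" for x
    proof -
      have "\<bar>(f' x - f' p) v\<bar> \<le> norm (f' x - f' p)"
        using norm_blinfun[of "f' x - f' p" v] v by simp
      then show ?thesis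
        using near[OF p that] pv by (simp add: minus_blinfun.rep_eq)
    qed
    with v show "\<exists>v. norm v = 1 \<and> (\<forall>x\<in>ball p \<rho>. m \<le> f' x v)"
      by blast
  qed (use \<rho> m ball in auto)
qed

text \<open>Translating \<open>\<zeta>\<close> and \<open>z\<close> by the same vector \<open>- s v\<close>, with \<open>s\<close> chosen so that \<open>\<zeta> - s v\<close> lies
  on the frontier, keeps \<open>\<zeta> - z\<close> and lowers \<open>r z\<close> by at least \<open>m s\<close>. This gain is comparable to
  \<open>r \<zeta>\<close> and absorbs the error \<open>L s |\<zeta> - z|\<close> caused by moving the base point of the gradient.\<close>
lemma near_bound:
  assumes p: "p \<in> frontier D" and ball: "ball p \<rho> \<subseteq> V" and "0 < \<rho>"
    and M: "\<And>x. x \<in> ball p \<rho> \<Longrightarrow> norm (f' x) \<le> M"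
    and "norm v = 1" and v: "\<And>x. x \<in> ball p \<rho> \<Longrightarrow> m \<le> f' x v"
    and "0 < m" "m \<le> M" "0 < c"
    and bound: "\<And>p z. p \<in> frontier D \<Longrightarrow> z \<in> closure D \<Longrightarrow>
      c * (norm (p - z))\<^sup>2 \<le> cmod (pairing p (p - z))"
    and k: "0 < k" "k * (2 + (L + 1) / c) = 1"
    and \<zeta>: "norm (\<zeta> - p) \<le> \<rho> / 8" "M * norm (\<zeta> - p) \<le> m * (\<rho> / 8)" "0 \<le> r \<zeta>"
    and z: "z \<in> closure D" "norm (\<zeta> - z) \<le> \<epsilon>"
    and \<epsilon>: "\<epsilon> \<le> \<rho> / 4" "L * \<epsilon> \<le> k * m / 2"
  shows "k * m / (2 * M) * (r \<zeta> - r z + (norm (\<zeta> - z))\<^sup>2) \<le> cmod (pairing \<zeta> (\<zeta> - z))"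
proof -
  \<comment> \<open>\<open>r \<zeta>\<close> is at most
    \<open>M * norm (\<zeta> - p) = m * S\<close>, and descending along \<open>v\<close> lowers
    \<open>r\<close> at rate at least \<open>m\<close>; hence \<open>r\<close> reaches 0 at some
    parameter \<open>s \<le> S\<close>.\<close>
  define S where "S = M * norm (\<zeta> - p) / m"
  have S: "0 \<le> S" "S \<le> \<rho> / 8" "m * S = M * norm (\<zeta> - p)"
    using \<zeta> assms(7,8) by (simp_all add: S_def field_simps)
  have in_ball: "\<zeta> - t *\<^sub>R v \<in> ball p \<rho>" "norm ((\<zeta> - t *\<^sub>R v) - p) \<le> \<rho> / 4" if "0 \<le> t" "t \<le> S" for t
  proof -
    have "(\<zeta> - t *\<^sub>R v) - p = (\<zeta> - p) - t *\<^sub>R v"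
      by simp
    also have "norm \<dots> \<le> norm (\<zeta> - p) + norm (t *\<^sub>R v)"
      by (rule norm_triangle_ineq4)
    also have "\<dots> \<le> \<rho> / 8 + t"
      using that \<zeta> \<open>norm v = 1\<close> by simp
    finally show "norm ((\<zeta> - t *\<^sub>R v) - p) \<le> \<rho> / 4"
      using that S by linarith
    then show "\<zeta> - t *\<^sub>R v \<in> ball p \<rho>"
      using \<open>0 < \<rho>\<close> by (simp add: dist_norm norm_minus_commute)
  qed
  have \<zeta>_ball: "\<zeta> \<in> ball p \<rho>"
    using in_ball(1)[of 0] S by simp
  have "r p = 0"
    using p frontier_in_V zero_iff by blast
  then have "r \<zeta> \<le> m * S"
    using increment_le[OF ball _ \<zeta>_ball M, of p] S(3) \<open>0 < \<rho>\<close> by simp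
  then have "r (\<zeta> - S *\<^sub>R v) \<le> 0"
    using descend[OF ball \<zeta>_ball in_ball(1)[of S] S(1) v] S by simp
  moreover have "continuous_on {0..S} (\<lambda>t. r (\<zeta> - t *\<^sub>R v))"
  proof (rule continuous_on_compose2[of V r])
    show "continuous_on V r"
      using derivative has_derivative_continuous continuous_at_imp_continuous_on by blast
    show "(\<lambda>t. \<zeta> - t *\<^sub>R v) ` {0..S} \<subseteq> V"
      using in_ball(1) ball by auto
  qed (intro continuous_intros)
  ultimately obtain s where s: "0 \<le> s" "s \<le> S" "r (\<zeta> - s *\<^sub>R v) = 0"
    using IVT2'[of "\<lambda>t. r (\<zeta> - t *\<^sub>R v)" S 0 0] S \<zeta>(3) by auto
  define q y where "q = \<zeta> - s *\<^sub>R v" and "y = z - s *\<^sub>R v"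
  have q_ball: "q \<in> ball p \<rho>" and qp: "norm (q - p) \<le> \<rho> / 4"
    using in_ball s by (simp_all add: q_def)
  have q: "q \<in> frontier D" "r q = 0"
    using q_ball ball s(3) zero_iff by (auto simp: q_def)
  have diff: "q - y = \<zeta> - z" "norm (\<zeta> - q) = s"
    using s \<open>norm v = 1\<close> by (simp_all add: q_def y_def)
  have y_ball: "y \<in> ball q (\<rho> / 2)"
    using z(2) \<epsilon>(1) \<open>0 < \<rho>\<close> diff(1) by (simp add: dist_norm)
  have sub: "ball q (\<rho> / 2) \<subseteq> ball p \<rho>"
    using qp \<open>0 < \<rho>\<close> by (subst ball_subset_ball_iff) (simp add: dist_norm)
  have "z \<in> ball p \<rho>"
  proof -
    have "norm (z - p) \<le> norm (\<zeta> - z) + norm (\<zeta> - p)"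
      using norm_triangle_ineq4[of "\<zeta> - p" "\<zeta> - z"] by simp
    then show ?thesis
      using z(2) \<zeta>(1) \<epsilon>(1) \<open>0 < \<rho>\<close> by (simp add: dist_norm norm_minus_commute)
  qed
  then have ry: "r y \<le> r z - m * s"
    unfolding y_def using descend[OF ball _ _ s(1) v] y_ball sub by (auto simp: y_def)
  have rz: "r z \<le> 0"
    using z(1) closure_subset closure_iff by blast
  have "0 \<le> m * s"
    using s \<open>0 < m\<close> by simp
  then have "y \<in> closure D"
    using y_ball sub ball ry rz closure_iff[of y] by (simp add: subset_iff)
  from bound[OF q(1) this]
  have "(norm (\<zeta> - z))\<^sup>2 - r y \<le> (2 + (L + 1) / c) * cmod (pairing q (\<zeta> - z))"
    using frontier_bound_strengthen[OF q(1) _ y_ball \<open>0 < c\<close>] sub ball diff by auto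
  then have "k * ((norm (\<zeta> - z))\<^sup>2 - r y) \<le> k * ((2 + (L + 1) / c) * cmod (pairing q (\<zeta> - z)))"
    using k by (intro mult_left_mono) auto
  also have "\<dots> = cmod (pairing q (\<zeta> - z))"
    using k(2) by (simp flip: mult.assoc)
  also have "\<dots> \<le> cmod (pairing \<zeta> (\<zeta> - z)) + cmod (pairing \<zeta> (\<zeta> - z) - pairing q (\<zeta> - z))"
    using norm_triangle_sub[of "pairing q (\<zeta> - z)" "pairing \<zeta> (\<zeta> - z)"]
    by (simp add: norm_minus_commute)
  also have "cmod (pairing \<zeta> (\<zeta> - z) - pairing q (\<zeta> - z)) \<le> L * s * norm (\<zeta> - z)"
    using norm_pairing_diff_le[of \<zeta> q "\<zeta> - z"] \<zeta>_ball q_ball subsetD[OF ball] diff(2) by simp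
  also have "L * s * norm (\<zeta> - z) \<le> L * s * \<epsilon>"
    using z(2) s L_nonneg by (intro mult_left_mono) auto
  also have "L * s * \<epsilon> \<le> s * (k * m / 2)"
    using mult_left_mono[OF \<epsilon>(2) s(1)] by (simp add: mult_ac)
  finally have main: "k * ((norm (\<zeta> - z))\<^sup>2 - r y) \<le> cmod (pairing \<zeta> (\<zeta> - z)) + s * (k * m / 2)"
    by simp
  have "k * ((norm (\<zeta> - z))\<^sup>2 - r z + m * s) \<le> k * ((norm (\<zeta> - z))\<^sup>2 - r y)"
    using ry k by (intro mult_left_mono) auto
  \<comment> \<open>Of the gain \<open>k * m * s\<close>, one half pays for moving the base point of
    the gradient; the other half remains.\<close>
  with main have gain: "k * ((norm (\<zeta> - z))\<^sup>2 - r z + m * s / 2) \<le> cmod (pairing \<zeta> (\<zeta> - z))"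
    by (simp add: algebra_simps)
  \<comment> \<open>Conversely \<open>s\<close> controls \<open>r \<zeta>\<close>, so the remaining
    gain supplies the term \<open>r \<zeta>\<close> of the claim.\<close>
  have "r \<zeta> \<le> M * s"
    using increment_le[OF ball q_ball \<zeta>_ball M] q diff by simp
  then have "m / (2 * M) * r \<zeta> \<le> m / (2 * M) * (M * s)"
    using \<open>0 < m\<close> \<open>m \<le> M\<close> by (intro mult_left_mono) auto
  also have "\<dots> = m * s / 2"
    using \<open>0 < m\<close> \<open>m \<le> M\<close> by simp
  finally have r\<zeta>: "m / (2 * M) * r \<zeta> \<le> m * s / 2" .
  have "m / (2 * M) * (r \<zeta> - r z + (norm (\<zeta> - z))\<^sup>2) =
      m / (2 * M) * r \<zeta> + m / (2 * M) * ((norm (\<zeta> - z))\<^sup>2 - r z)"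
    by (simp only: algebra_simps)
  also have "\<dots> \<le> m * s / 2 + 1 * ((norm (\<zeta> - z))\<^sup>2 - r z)"
    using \<open>0 < m\<close> \<open>m \<le> M\<close> order_trans[OF rz zero_le_power2]
    by (intro add_mono r\<zeta> mult_right_mono) auto
  finally have "m / (2 * M) * (r \<zeta> - r z + (norm (\<zeta> - z))\<^sup>2) \<le> (norm (\<zeta> - z))\<^sup>2 - r z + m * s / 2"
    by simp
  then have "k * (m / (2 * M) * (r \<zeta> - r z + (norm (\<zeta> - z))\<^sup>2)) \<le> k * ((norm (\<zeta> - z))\<^sup>2 - r z + m * s / 2)"
    using k by (intro mult_left_mono) auto
  with gain show ?thesis
    by simp
qed

section \<open>Distant points and the extension of the bound to a neighborhood\<close>

text \<open>Here \<open>norm (p - z)\<close> is at least \<open>\<epsilon> / 2\<close>, so the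
  pairing at \<open>p\<close> is at least \<open>c * \<epsilon>\<^sup>2 / 4\<close>. Moving
  \<open>p\<close> to \<zeta> changes the vector and the gradient, with total error at most
  \<open>(M + L * B) * \<eta>\<close>, half of that.\<close>

lemma far_bound:
  assumes p: "p \<in> frontier D" and "\<zeta> \<in> V" and M: "norm (f' \<zeta>) \<le> M"
    and "0 < c" and bound: "c * (norm (p - z))\<^sup>2 \<le> cmod (pairing p (p - z))"
    and far: "\<epsilon> \<le> norm (\<zeta> - z)" "0 < \<epsilon>"
    and \<eta>: "norm (\<zeta> - p) \<le> \<eta>" "\<eta> \<le> \<epsilon> / 2" "(M + L * B) * \<eta> \<le> c * \<epsilon>\<^sup>2 / 8"
    and B: "norm (p - z) \<le> B"
  shows "c * \<epsilon>\<^sup>2 / 8 \<le> cmod (pairing \<zeta> (\<zeta> - z))"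
proof -
  have "\<epsilon> / 2 \<le> norm (p - z)"
    using norm_triangle_ineq[of "\<zeta> - p" "p - z"] far \<eta> by simp
  then have "(\<epsilon> / 2)\<^sup>2 \<le> (norm (p - z))\<^sup>2"
    using far by (intro power_mono) auto
  then have "c * (\<epsilon> / 2)\<^sup>2 \<le> c * (norm (p - z))\<^sup>2"
    using \<open>0 < c\<close> by (intro mult_left_mono) auto
  with bound have "c * \<epsilon>\<^sup>2 / 4 \<le> cmod (pairing p (p - z))"
    by (simp add: power_divide)
  also have "pairing p (p - z) =
      pairing \<zeta> (\<zeta> - z) - pairing \<zeta> (\<zeta> - p) - (pairing \<zeta> (p - z) - pairing p (p - z))"
    using cdot_add_right[of "wirtinger_grad r \<zeta>" "\<zeta> - p" "p - z"] by simp
  also have "cmod \<dots> \<le> cmod (pairing \<zeta> (\<zeta> - z)) + cmod (pairing \<zeta> (\<zeta> - p))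
      + cmod (pairing \<zeta> (p - z) - pairing p (p - z))"
    by (meson add_right_mono norm_triangle_ineq4 order_trans)
  also have "cmod (pairing \<zeta> (\<zeta> - p)) \<le> norm (f' \<zeta>) * norm (\<zeta> - p)"
    using \<open>\<zeta> \<in> V\<close> by (rule norm_pairing_le)
  also have "\<dots> \<le> M * \<eta>"
    using M \<eta>(1) order_trans[OF norm_ge_zero M] by (intro mult_mono) auto
  also have "cmod (pairing \<zeta> (p - z) - pairing p (p - z)) \<le> L * norm (\<zeta> - p) * norm (p - z)"
    using \<open>\<zeta> \<in> V\<close> p frontier_in_V by (intro norm_pairing_diff_le) auto
  also have "\<dots> \<le> L * \<eta> * B"
    using L_nonneg \<eta>(1) B order_trans[OF norm_ge_zero \<eta>(1)] by (intro mult_mono) auto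
  finally show ?thesis
    using \<eta>(3) by (simp add: algebra_simps)
qed

text \<open>The threshold \<open>\<epsilon>\<close> on \<open>norm (\<zeta> - z)\<close> separates
  the cases of \<open>near_bound\<close> and \<open>far_bound\<close>. In the far case a positive
  lower bound for the pairing suffices, since the bracket on the left is bounded.\<close>

lemma bound_extends:
  assumes "0 < c"
    and bound: "\<And>p z. p \<in> frontier D \<Longrightarrow> z \<in> closure D \<Longrightarrow>
      c * (norm (p - z))\<^sup>2 \<le> cmod (pairing p (p - z))"
  obtains U k where "open U" "closure D \<subseteq> U" "U \<subseteq> V" "0 < k"
    and "\<And>\<zeta> z. z \<in> closure D \<Longrightarrow> \<zeta> \<in> U - D \<Longrightarrow>
      k * (r \<zeta> - r z + (norm (\<zeta> - z))\<^sup>2) \<le> cmod (pairing \<zeta> (\<zeta> - z))"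
proof -
  obtain \<rho> m M where col: "0 < \<rho>" "0 < m" "m \<le> M"
      "\<And>p. p \<in> closure D \<Longrightarrow> ball p \<rho> \<subseteq> V"
      "\<And>p x. p \<in> frontier D \<Longrightarrow> x \<in> ball p \<rho> \<Longrightarrow> norm (f' x) \<le> M"
      "\<And>p. p \<in> frontier D \<Longrightarrow> \<exists>v. norm v = 1 \<and> (\<forall>x\<in>ball p \<rho>. m \<le> f' x v)"
    using collar by metis
  have "compact (closure D)"
    using bounded_D by simp
  then obtain B where B: "0 < B" "\<And>x. x \<in> closure D \<Longrightarrow> norm x \<le> B"
    using compact_imp_bounded[of "closure D"] by (auto simp: bounded_pos)
  have "continuous_on (closure D) r"
    using derivative has_derivative_continuous closure_subset
    by (meson continuous_at_imp_continuous_on subsetD)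
  then have "bounded (r ` closure D)"
    using \<open>compact (closure D)\<close> by (intro compact_imp_bounded compact_continuous_image)
  then obtain R where R: "0 < R" "\<And>x. x \<in> closure D \<Longrightarrow> \<bar>r x\<bar> \<le> R"
    by (auto simp: bounded_pos)
  \<comment> \<open>The inverse of the constant in \<open>frontier_bound_strengthen\<close>.\<close>
  define k where "k = 1 / (2 + (L + 1) / c)"
  have "0 < 2 + (L + 1) / c"
    using L_nonneg \<open>0 < c\<close> by (simp add: add_pos_nonneg)
  then have k: "0 < k" "k * (2 + (L + 1) / c) = 1"
    by (simp_all add: k_def)
  \<comment> \<open>The first entry keeps \<open>z\<close> and its translate in the balls; the
    second lets the gain absorb the gradient error.\<close>
  define \<epsilon> where "\<epsilon> = min (\<rho> / 4) (k * m / 2 / (L + 1))"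
  have \<epsilon>: "0 < \<epsilon>" "\<epsilon> \<le> \<rho> / 4" "L * \<epsilon> \<le> k * m / 2"
  proof -
    show "0 < \<epsilon>"
      using col(1,2) k(1) L_nonneg by (simp add: \<epsilon>_def)
    show "\<epsilon> \<le> \<rho> / 4"
      unfolding \<epsilon>_def by (rule min.cobounded1)
    have "\<epsilon> \<le> k * m / 2 / (L + 1)"
      unfolding \<epsilon>_def by (rule min.cobounded2)
    then have "\<epsilon> * (L + 1) \<le> k * m / 2"
      by (subst (asm) pos_le_divide_eq) (use L_nonneg in auto)
    with \<open>0 < \<epsilon>\<close> show "L * \<epsilon> \<le> k * m / 2"
      by (simp add: algebra_simps)
  qed
  define N where "N = M + L * (2 * B)"
  have N: "0 < N"
    using col B L_nonneg by (simp add: N_def add_pos_nonneg)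
  \<comment> \<open>The entry 1 serves the bound \<open>Q\<close>, the next two keep the translation
    of \<open>near_bound\<close> inside the ball, and the last two are what \<open>far_bound\<close>
    requires, with \<open>2 * B\<close> bounding \<open>norm (p - z)\<close>.\<close>
  define \<eta> where "\<eta> = Min {1, \<rho> / 8, m * (\<rho> / 8) / M, \<epsilon> / 2, c * \<epsilon>\<^sup>2 / 8 / N}"
  have \<eta>: "0 < \<eta>" "\<eta> \<le> 1" "\<eta> \<le> \<rho> / 8" "\<eta> \<le> \<epsilon> / 2"
    using col \<epsilon> N \<open>0 < c\<close> by (simp_all add: \<eta>_def)
  have "\<eta> \<le> m * (\<rho> / 8) / M" "\<eta> \<le> c * \<epsilon>\<^sup>2 / 8 / N"
    by (simp_all add: \<eta>_def)
  then have \<eta>': "M * \<eta> \<le> m * (\<rho> / 8)" "N * \<eta> \<le> c * \<epsilon>\<^sup>2 / 8"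
    using col(2,3) N by (simp_all add: pos_le_divide_eq mult_ac)
  \<comment> \<open>The summands bound \<open>r \<zeta>\<close>, \<open>- r z\<close> and the
    squared distance.\<close>
  define Q where "Q = M + R + (2 * B + 1)\<^sup>2"
  have Q: "0 < Q"
    using col R by (simp add: Q_def add_pos_nonneg)
  define K where "K = min (k * m / (2 * M)) (c * \<epsilon>\<^sup>2 / 8 / Q)"
  have K: "0 < K" "K \<le> k * m / (2 * M)" "K \<le> c * \<epsilon>\<^sup>2 / 8 / Q"
    using col k \<epsilon> Q \<open>0 < c\<close> by (simp_all add: K_def)
  define U where "U = (\<Union>p\<in>closure D. ball p \<eta>)"
  have UV: "U \<subseteq> V"
    using col(1,4) \<eta> by (fastforce simp: U_def)
  show thesis
  proof (rule that[of U K])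
    show "open U" "closure D \<subseteq> U"
      using \<eta> by (auto simp: U_def)
    fix \<zeta> z assume z: "z \<in> closure D" and \<zeta>: "\<zeta> \<in> U - D"
    have \<zeta>V: "\<zeta> \<in> V"
      using \<zeta> UV by auto
    have r\<zeta>: "0 \<le> r \<zeta>"
      using neg_iff[OF \<zeta>V] \<zeta> by auto
    have rz: "r z \<le> 0"
      using z closure_subset closure_iff by blast
    have nonneg: "0 \<le> r \<zeta> - r z + (norm (\<zeta> - z))\<^sup>2"
      using r\<zeta> rz by simp
    obtain q where q: "q \<in> closure D" "norm (\<zeta> - q) < \<eta>"
      using \<zeta> by (auto simp: U_def dist_norm norm_minus_commute)
    obtain p where p: "p \<in> frontier D" "norm (\<zeta> - p) < \<eta>"
    proof (cases "q \<in> D")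
      case True
      with \<zeta> obtain u where u: "u \<in> frontier D" "u \<in> closed_segment q \<zeta>"
        using closed_segment_meets_frontier by blast
      then have "norm (\<zeta> - u) \<le> norm (\<zeta> - q)"
        using segment_bound(2)[of u q \<zeta>] by (simp add: norm_minus_commute)
      with u q that show thesis
        by auto
    next
      case False
      with q that show thesis
        using open_D by (simp add: frontier_def interior_open)
    qed
    have pcl: "p \<in> closure D"
      using p by (simp add: frontier_def)
    have \<zeta>_ball: "\<zeta> \<in> ball p \<rho>"
      using p \<eta> col(1) by (simp add: dist_norm norm_minus_commute)
    show "K * (r \<zeta> - r z + (norm (\<zeta> - z))\<^sup>2) \<le> cmod (pairing \<zeta> (\<zeta> - z))"
    proof (cases "norm (\<zeta> - z) \<le> \<epsilon>")
      case True
      obtain v where v: "norm v = 1" "\<And>x. x \<in> ball p \<rho> \<Longrightarrow> m \<le> f' x v"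
        using col(6)[OF p(1)] by blast
      have "M * norm (\<zeta> - p) \<le> M * \<eta>"
        using p col by (intro mult_left_mono) auto
      then have "k * m / (2 * M) * (r \<zeta> - r z + (norm (\<zeta> - z))\<^sup>2) \<le> cmod (pairing \<zeta> (\<zeta> - z))"
        using p \<eta> \<eta>'
        by (intro near_bound[OF p(1) col(4)[OF pcl] col(1) col(5)[OF p(1)] v col(2,3) \<open>0 < c\<close>
              bound k _ _ r\<zeta> z True \<epsilon>(2,3)]) auto
      with mult_right_mono[OF K(2) nonneg] show ?thesis
        by linarith
    next
      case False
      have pz: "norm (p - z) \<le> 2 * B"
        using norm_triangle_ineq4[of p z] B(2)[OF pcl] B(2)[OF z] by linarith
      have "c * \<epsilon>\<^sup>2 / 8 \<le> cmod (pairing \<zeta> (\<zeta> - z))"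
        using False \<epsilon>(1) p \<eta>(4) \<eta>'(2)
        by (intro far_bound[OF p(1) \<zeta>V col(5)[OF p(1) \<zeta>_ball] \<open>0 < c\<close> bound[OF p(1) z] _ _ _ _ _ pz])
          (auto simp: N_def)
      moreover have "r \<zeta> - r z + (norm (\<zeta> - z))\<^sup>2 \<le> Q"
      proof -
        have "r p = 0"
          using p(1) frontier_in_V zero_iff by blast
        then have "r \<zeta> \<le> M * norm (\<zeta> - p)"
          using increment_le[OF col(4)[OF pcl] _ \<zeta>_ball col(5)[OF p(1)], of p] col(1) by simp
        also have "\<dots> \<le> M * 1"
          using p \<eta> col by (intro mult_left_mono) auto
        finally have "r \<zeta> \<le> M"
          by simp
        moreover have "norm (\<zeta> - z) \<le> 2 * B + 1"
          using norm_triangle_ineq[of "\<zeta> - p" "p - z"] pz p \<eta> by simp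
        then have "(norm (\<zeta> - z))\<^sup>2 \<le> (2 * B + 1)\<^sup>2"
          by (intro power_mono) auto
        ultimately show ?thesis
          using R(2)[OF z] by (simp add: Q_def)
      qed
      then have "K * (r \<zeta> - r z + (norm (\<zeta> - z))\<^sup>2) \<le> c * \<epsilon>\<^sup>2 / 8 / Q * Q"
        using K nonneg by (intro mult_mono) auto
      ultimately show ?thesis
        using Q by simp
    qed
  qed (use UV K in auto)
qed

end

section \<open>From the definitions to the equivalences\<close>

text \<open>\<open>D\<close> is open as a strict sublevel set of a function continuous on the open
  set \<open>W\<close>. Nonvanishing passes from \<open>frechet_derivative\<close> to
  \<open>f'\<close> by uniqueness of the derivative.\<close>

lemma C11_defining_function_imp_c11_defining:
  fixes r :: "complex ^ 'n \<Rightarrow> real"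
  assumes "bounded D" "C11_defining_function r W D"
  obtains V f' L where "c11_defining D V r f' L" "V \<subseteq> W"
proof -
  have W: "D = {x \<in> W. r x < 0}" "frontier D = {x \<in> W. r x = 0}" "open W" "C1_on W r"
    and nonzero: "\<And>x. x \<in> frontier D \<Longrightarrow> frechet_derivative r (at x) \<noteq> (\<lambda>_. 0)"
    using assms(2) unfolding C11_defining_function_def defining_function_def by blast+
  obtain V f' L where V: "open V" "closure D \<subseteq> V" "V \<subseteq> W"
      "\<And>x. x \<in> V \<Longrightarrow> (r has_derivative blinfun_apply (f' x)) (at x)" "L-lipschitz_on V f'"
    using assms(2) unfolding C11_defining_function_def C11_on_def by blast
  have "continuous_on W r"
    using W(4) has_derivative_continuous continuous_at_imp_continuous_on
    unfolding C1_on_def by blast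
  then have "open (W \<inter> r -` {..<0})"
    using \<open>open W\<close> by (simp add: continuous_on_open_vimage Int_commute)
  also have "W \<inter> r -` {..<0} = D"
    using W(1) by auto
  finally have "open D" .
  show thesis
  proof (rule that[of V f' L])
    show "c11_defining D V r f' L"
    proof
      fix p assume p: "p \<in> frontier D"
      then have "p \<in> V"
        using V by (auto simp: frontier_def)
      from V(4)[OF this] show "f' p \<noteq> 0"
        using nonzero[OF p] frechet_derivative_at by (metis zero_blinfun.rep_eq)
    qed (use assms W V \<open>open D\<close> in auto)
  qed (use V in auto)
qed

text \<open>The neighborhoods in \<open>cond1\<close> and \<open>cond2\<close> are required to lie
  in \<open>W\<close>, because values of \<open>r\<close> outside \<open>W\<close> carry no
  meaning.\<close>

theorem theorem1p1:
  fixes D W :: "(complex ^ 'n) set" and r :: "complex ^ 'n \<Rightarrow> real"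
  assumes "bounded D" and "C11_domain D"
    and "C11_defining_function r W D"
  defines "cond0 \<equiv> \<exists>c>0. \<forall>z\<in>closure D. \<forall>\<zeta>\<in>frontier D.
      cmod (cdot (wirtinger_grad r \<zeta>) (\<zeta> - z)) \<ge> c * (norm (\<zeta> - z))\<^sup>2"
    and "cond1 \<equiv> \<exists>U. open U \<and> closure D \<subseteq> U \<and> U \<subseteq> W \<and>
      (\<exists>c\<^sub>1>0. \<forall>z\<in>closure D. \<forall>\<zeta>\<in>U - D.
        cmod (cdot (wirtinger_grad r \<zeta>) (\<zeta> - z)) \<ge> c\<^sub>1 * (norm (\<zeta> - z))\<^sup>2)"
    and "cond2 \<equiv> \<exists>U. open U \<and> closure D \<subseteq> U \<and> U \<subseteq> W \<and>
      (\<exists>c\<^sub>2>0. \<forall>z\<in>closure D. \<forall>\<zeta>\<in>U - D.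
        cmod (cdot (wirtinger_grad r \<zeta>) (\<zeta> - z)) \<ge> c\<^sub>2 * (r \<zeta> - r z + (norm (\<zeta> - z))\<^sup>2))"
    and "cond3 \<equiv> \<exists>c\<^sub>3>0. \<forall>\<zeta>\<in>frontier D. \<forall>z\<in>frontier D.
      cmod (cdot (wirtinger_grad r \<zeta>) (\<zeta> - z)) \<ge> c\<^sub>3 * (norm (\<zeta> - z))\<^sup>2"
  shows "(cond0 \<longleftrightarrow> cond1) \<and> (cond0 \<longleftrightarrow> cond2) \<and> (cond0 \<longleftrightarrow> cond3)"
proof -
  obtain V f' L where "c11_defining D V r f' L" and VW: "V \<subseteq> W"
    using C11_defining_function_imp_c11_defining assms(1,3) by blast
  then interpret c11_defining D V r f' L
    by simp
  have W: "D = {x \<in> W. r x < 0}" "frontier D = {x \<in> W. r x = 0}"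
    using assms(3) unfolding C11_defining_function_def defining_function_def by blast+
  \<comment> \<open>Since \<open>D\<close> is open, it misses its frontier; this makes
    \<open>cond0\<close> a restriction of \<open>cond1\<close>.\<close>
  have frontier_sub: "frontier D \<subseteq> U - D" if "closure D \<subseteq> U" for U
    using that open_D by (auto simp: frontier_def interior_open)
  have r_le: "0 \<le> r \<zeta> - r z" if "\<zeta> \<in> W - D" "z \<in> closure D" for \<zeta> z
    using that W(1) closure_iff[of z] closure_subset by (force simp: not_less)
  have "cond2" if "cond0"
  proof -
    obtain c where "0 < c" "\<And>p z. p \<in> frontier D \<Longrightarrow> z \<in> closure D \<Longrightarrow>
        c * (norm (p - z))\<^sup>2 \<le> cmod (pairing p (p - z))"
      using \<open>cond0\<close> unfolding cond0_def by blast
    then obtain U k where "open U" "closure D \<subseteq> U" "U \<subseteq> V" "0 < k"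
        "\<And>\<zeta> z. z \<in> closure D \<Longrightarrow> \<zeta> \<in> U - D \<Longrightarrow>
          k * (r \<zeta> - r z + (norm (\<zeta> - z))\<^sup>2) \<le> cmod (pairing \<zeta> (\<zeta> - z))"
      using bound_extends by metis
    with VW show ?thesis
      unfolding cond2_def by (meson subset_trans)
  qed
  moreover have "cond1" if "cond2"
  proof -
    obtain U c where U: "open U" "closure D \<subseteq> U" "U \<subseteq> W" "0 < c"
        "\<And>\<zeta> z. z \<in> closure D \<Longrightarrow> \<zeta> \<in> U - D \<Longrightarrow>
          c * (r \<zeta> - r z + (norm (\<zeta> - z))\<^sup>2) \<le> cmod (pairing \<zeta> (\<zeta> - z))"
      using \<open>cond2\<close> unfolding cond2_def by blast
    have "c * (norm (\<zeta> - z))\<^sup>2 \<le> cmod (pairing \<zeta> (\<zeta> - z))"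
      if "z \<in> closure D" "\<zeta> \<in> U - D" for \<zeta> z
    proof -
      have "c * (norm (\<zeta> - z))\<^sup>2 \<le> c * (r \<zeta> - r z + (norm (\<zeta> - z))\<^sup>2)"
        using r_le[of \<zeta> z] that U by (intro mult_left_mono) auto
      with U(5)[OF that] show ?thesis
        by linarith
    qed
    then show ?thesis
      unfolding cond1_def using U(1-4) by (intro exI[of _ U] conjI exI[of _ c] ballI) auto
  qed
  moreover have "cond0" if "cond1"
  proof -
    obtain U c where U: "closure D \<subseteq> U" "0 < c"
        "\<forall>z\<in>closure D. \<forall>\<zeta>\<in>U - D. c * (norm (\<zeta> - z))\<^sup>2 \<le> cmod (pairing \<zeta> (\<zeta> - z))"
      using \<open>cond1\<close> unfolding cond1_def by blast
    show ?thesis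
      unfolding cond0_def using frontier_sub[OF U(1)] U(2,3) by (intro exI[of _ c]) auto
  qed
  moreover have "cond3" if "cond0"
    using that unfolding cond0_def cond3_def frontier_def by blast
  moreover have "cond0" if "cond3"
  proof -
    obtain c where "0 < c"
        and c: "\<And>\<zeta> z. \<zeta> \<in> frontier D \<Longrightarrow> z \<in> frontier D \<Longrightarrow>
          c * (norm (\<zeta> - z))\<^sup>2 \<le> cmod (pairing \<zeta> (\<zeta> - z))"
      using \<open>cond3\<close> unfolding cond3_def by blast
    have "c * (norm (\<zeta> - z))\<^sup>2 \<le> cmod (pairing \<zeta> (\<zeta> - z))"
      if "z \<in> closure D" "\<zeta> \<in> frontier D" for \<zeta> z
      using cdot_bound_closure_if_frontier[OF bounded_D open_D that(2) \<open>0 < c\<close> c[OF that(2)] that(1)] .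
    with \<open>0 < c\<close> show ?thesis
      unfolding cond0_def by blast
  qed
  ultimately show ?thesis
    by blast
qed

end
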